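(* Let $d\ge 2$ be even. (1) If $f(z)=\dfrac{z^d-a}{z^d+a}$ for some $a\in\mathbb{C}$, $a\neq 0$, then $\mathrm{Deck}(f^2)\cong D_{2d}$. (2) If $g(z)=\dfrac{z^d-1}{z^d+1}$, then $\mathrm{Deck}(g^3)\cong D_{4d}$.
   Context: $f$ and $g$ are regarded as rational maps of the Riemann sphere $\hat{\mathbb{C}}$, and $f^k$ denotes the $k$-th iterate (composition). The deck group of a rational map $F$ is $\mathrm{Deck}(F)=\{\mu \text{ a Möbius transformation of } \hat{\mathbb{C}} : F\circ\mu=F\}$, a group under composition. For $n\ge2$, $D_{2n}=\langle R,F\mid R^n=F^2=(RF)^2=\mathrm{id}\rangle$ is the dihedral group of order $2n$; in particular $D_4$ is the Klein four-group. *)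

theory Defs
  imports Complex_Main "HOL-Computational_Algebra.Polynomial" "HOL-Algebra.Group"
begin

text \<open>
  The Riemann sphere is the one-point compactification \<^typ>\<open>complex option\<close>, with
  \<^term>\<open>None\<close> as the point at infinity.
\<close>

type_synonym rsphere = "complex option"

text \<open>
  The map \<open>p / q\<close> of the sphere, for coprime \<open>p\<close> and \<open>q\<close> (with common roots the value
  there would be wrong, since no cancellation is performed). The value at infinity is
  the limit of \<open>p z / q z\<close>: the ratio of the coefficients of degree
  \<open>max (degree p) (degree q)\<close>.
\<close>

definition rat_map :: "complex poly \<Rightarrow> complex poly \<Rightarrow> rsphere \<Rightarrow> rsphere" where
  "rat_map p q w =
    (case w of
      Some z \<Rightarrow> if poly q z = 0 then None else Some (poly p z / poly q z)
    | None \<Rightarrow>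
        let n = max (degree p) (degree q)
        in if coeff q n = 0 then None else Some (coeff p n / coeff q n))"

definition moebius_maps :: "(rsphere \<Rightarrow> rsphere) set" where
  "moebius_maps = {rat_map [:b, a:] [:d, c:] | a b c d. a * d - b * c \<noteq> 0}"

definition deck_group :: "(rsphere \<Rightarrow> rsphere) \<Rightarrow> (rsphere \<Rightarrow> rsphere) monoid" where
  "deck_group F = \<lparr>carrier = {\<mu> \<in> moebius_maps. F \<circ> \<mu> = F}, monoid.mult = (\<circ>), one = id\<rparr>"

text \<open>
  Groups given by generators and relators. The generators are all elements of the type
  \<open>'g\<close>; in a word, the letter \<open>(x, True)\<close> is the generator \<open>x\<close> and \<open>(x, False)\<close> is its
  inverse. The group is the set of words modulo the congruence generated by free
  cancellation and by deleting relators.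
\<close>

inductive pres_eq :: "('g \<times> bool) list set \<Rightarrow> ('g \<times> bool) list \<Rightarrow> ('g \<times> bool) list \<Rightarrow> bool"
  for rels where
  refl: "pres_eq rels u u"
| sym: "pres_eq rels u v \<Longrightarrow> pres_eq rels v u"
| trans: "pres_eq rels u v \<Longrightarrow> pres_eq rels v w \<Longrightarrow> pres_eq rels u w"
| cancel: "pres_eq rels (u @ [(x, b), (x, \<not> b)] @ v) (u @ v)"
| relator: "r \<in> rels \<Longrightarrow> pres_eq rels (u @ r @ v) (u @ v)"

definition presented_group :: "('g \<times> bool) list set \<Rightarrow> ('g \<times> bool) list set monoid" where
  "presented_group rels =
    \<lparr>carrier = UNIV // {(u, v). pres_eq rels u v},
     monoid.mult = (\<lambda>A B. {w. \<exists>u\<in>A. \<exists>v\<in>B. pres_eq rels (u @ v) w}),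
     one = {w. pres_eq rels [] w}\<rparr>"

datatype dihedral_gen = Rot | Flip

text \<open>The dihedral group of order \<open>2 * n\<close>; note that the index is \<open>n\<close>, not the order.\<close>

definition dihedral_group :: "nat \<Rightarrow> (dihedral_gen \<times> bool) list set monoid" where
  "dihedral_group n = presented_group
    {replicate n (Rot, True),
     [(Flip, True), (Flip, True)],
     [(Rot, True), (Flip, True), (Rot, True), (Flip, True)]}"

end

theory Submission
  imports Defs
begin

text \<open>
  Write \<open>f z = (z^d - a) / (z^d + a)\<close> as \<open>M (z^d)\<close> with \<open>M\<close> a Moebius map. Two points have the
  same image under \<open>f\<close> exactly when their \<open>d\<close>-th powers agree, and simple substitutions are
  intertwined by \<open>f\<close>: \<open>c^d = 1\<close> gives \<open>f (c z) = f z\<close>, \<open>c^d = a^2\<close> gives \<open>f (c / z) = - f z\<close>, and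
  \<open>c^d = -1\<close> gives \<open>f (c z) = 1 / f z\<close>. Since \<open>d\<close> is even, \<open>f (- z) = f z\<close>. Hence all \<open>z \<mapsto> c z\<close>
  with \<open>c^d = 1\<close> and all \<open>z \<mapsto> c / z\<close> with \<open>c^d = a^2\<close> are deck transformations of \<open>f^2\<close>. For
  \<open>a = 1\<close> the map \<open>z \<mapsto> 1 / z\<close> is among them, so that \<open>c^(2d) = 1\<close> suffices for \<open>f^3\<close>.

  That nothing else occurs rests on a rigidity statement, \<open>moebius_preserving_nth_roots\<close>: a Moebius
  map sending the set \<open>{z. z^n = A}\<close>, with \<open>n \<ge> 3\<close> and \<open>A \<noteq> 0\<close>, into itself is \<open>z \<mapsto> c z\<close> or
  \<open>z \<mapsto> c / z\<close>. It remains to find a regular polygon which every deck transformation preserves.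
  For \<open>f^2\<close> the fibres over \<open>-1\<close> and \<open>1\<close> are \<open>{z. z^d = a}\<close> and \<open>{z. z^d = -a}\<close>; their union is
  \<open>{z. z^(2d) = a^2}\<close>, which has \<open>2d \<ge> 4\<close> points even when \<open>d = 2\<close>, and the first fibre
  alone then determines the admissible \<open>c\<close>. For \<open>a = 1\<close> and \<open>f^3\<close> the polygon \<open>{z. z^(2d) = 1}\<close> is only part of
  a fibre when \<open>d > 2\<close>, namely the set of critical points in the fibre over \<open>0\<close>; deck
  transformations preserve it because criticality is preserved by the chain rule
  (\<open>deck_third_iterate_preserves_critical_fibre\<close>).

  Finally, the maps \<open>z \<mapsto> c z\<close> with \<open>c^n = 1\<close> and \<open>z \<mapsto> c / z\<close> with \<open>c^n = C\<close> satisfy the dihedral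
  relations, and since the presentation allows every word to be rewritten as one of the \<open>2n\<close> words
  \<open>R^k F^e\<close>, which give distinct maps, they form the presented group and not a proper quotient of it
  (\<open>rotations_inversions_dihedral\<close>).
\<close>

section \<open>Rotations and inversions of the sphere\<close>

definition rotation :: "complex \<Rightarrow> rsphere \<Rightarrow> rsphere" where
  "rotation c = rat_map [:0, c:] [:1:]"

definition inversion :: "complex \<Rightarrow> rsphere \<Rightarrow> rsphere" where
  "inversion c = rat_map [:c:] [:0, 1:]"

lemma rotation_Some [simp]: "rotation c (Some z) = Some (c * z)"
  by (simp add: rotation_def rat_map_def mult.commute)

lemma rotation_None [simp]: "c \<noteq> 0 \<Longrightarrow> rotation c None = None"
  by (simp add: rotation_def rat_map_def)

lemma inversion_Some [simp]: "inversion c (Some z) = (if z = 0 then None else Some (c / z))"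
  by (simp add: inversion_def rat_map_def)

lemma inversion_None [simp]: "inversion c None = Some 0"
  by (simp add: inversion_def rat_map_def)

lemma rsphere_eqI:
  fixes F G :: "rsphere \<Rightarrow> rsphere"
  assumes "F None = G None" and "\<And>z. F (Some z) = G (Some z)"
  shows "F = G"
  using assms by (metis ext option.exhaust)

lemma rotation_1 [simp]: "rotation 1 = id"
  by (rule rsphere_eqI) auto

lemma rotation_rotation: "c \<noteq> 0 \<Longrightarrow> e \<noteq> 0 \<Longrightarrow> rotation c \<circ> rotation e = rotation (c * e)"
  by (rule rsphere_eqI) auto

lemma rotation_inversion: "c \<noteq> 0 \<Longrightarrow> rotation c \<circ> inversion e = inversion (c * e)"
  by (rule rsphere_eqI) auto

lemma inversion_rotation: "e \<noteq> 0 \<Longrightarrow> inversion c \<circ> rotation e = inversion (c / e)"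
  by (rule rsphere_eqI) auto

lemma inversion_inversion: "c \<noteq> 0 \<Longrightarrow> e \<noteq> 0 \<Longrightarrow> inversion c \<circ> inversion e = rotation (c / e)"
  by (rule rsphere_eqI) auto

lemma rotation_eq_iff [simp]: "rotation c = rotation e \<longleftrightarrow> c = e"
  by (metis mult.right_neutral option.inject rotation_Some)

lemma inversion_eq_iff [simp]: "inversion c = inversion e \<longleftrightarrow> c = e"
  by (metis div_by_1 inversion_Some option.inject zero_neq_one)

lemma rotation_neq_inversion [simp]: "rotation c \<noteq> inversion e" "inversion e \<noteq> rotation c"
proof -
  show "rotation c \<noteq> inversion e"
  proof
    assume "rotation c = inversion e"
    then have "rotation c (Some 0) = inversion e (Some 0)" by simp
    then show False by simp
  qed
  then show "inversion e \<noteq> rotation c" by metis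
qed

lemma rotation_moebius: "c \<noteq> 0 \<Longrightarrow> rotation c \<in> moebius_maps"
  unfolding moebius_maps_def rotation_def
  by (rule CollectI, rule exI[of _ c], rule exI[of _ 0], rule exI[of _ 0], rule exI[of _ 1]) auto

lemma inversion_moebius: "c \<noteq> 0 \<Longrightarrow> inversion c \<in> moebius_maps"
  unfolding moebius_maps_def inversion_def
  by (rule CollectI, rule exI[of _ 0], rule exI[of _ c], rule exI[of _ 1], rule exI[of _ 0]) auto

section \<open>Moebius maps preserving the vertices of a regular polygon\<close>

text \<open>
  If \<open>\<mu> z = (a z + b) / (c z + e)\<close>, then \<open>(a z + b)^n - A (c z + e)^n\<close> has degree at most \<open>n\<close> and
  vanishes at all \<open>n\<close> roots of \<open>z^n = A\<close>, so it is a multiple of \<open>z^n - A\<close> and its middle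
  coefficients are zero. Those at \<open>z\<close> and \<open>z^2\<close> already force \<open>a b = 0 = c e\<close>; both are middle
  coefficients because \<open>n \<ge> 3\<close>. For \<open>n = 2\<close> the conclusion fails: the Moebius maps fixing two given
  points form an infinite family.
\<close>

lemma moebius_preserving_nth_roots:
  assumes mu: "\<mu> \<in> moebius_maps" and n: "n \<ge> 3" and A: "A \<noteq> 0"
    and pres: "\<And>z. z ^ n = A \<Longrightarrow> \<exists>w. \<mu> (Some z) = Some w \<and> w ^ n = A"
  obtains c where "c \<noteq> 0" "\<mu> = rotation c \<or> \<mu> = inversion c"
proof -
  from mu obtain a b c e where m: "\<mu> = rat_map [:b, a:] [:e, c:]" and det: "a * e - b * c \<noteq> 0"
    unfolding moebius_maps_def by blast
  define p where "p = [:b, a:] ^ n - smult A ([:e, c:] ^ n)"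
  define k where "k = coeff p n"
  have root: "poly p z = 0" if "z ^ n = A" for z
  proof -
    from pres[OF that] have "e + z * c \<noteq> 0 \<and> ((b + z * a) / (e + z * c)) ^ n = A"
      by (auto simp: m rat_map_def split: if_splits)
    then show ?thesis
      by (auto simp: p_def power_divide poly_power field_simps)
  qed
  have deg: "degree ([:x, y:] ^ n) \<le> n" for x y :: complex
    using degree_power_le[of "[:x, y:]" n] by (auto split: if_splits)
  have "p = smult k (monom 1 n - [:A:])"
  proof (rule poly_eqI_degree_lead_coeff[where A = "{z. z ^ n = A}" and n = n])
    show "coeff p n = coeff (smult k (monom 1 n - [:A:])) n"
      using n by (simp add: k_def coeff_pCons split: nat.splits)
    show "n \<le> card {z. z ^ n = A}"
      using card_nth_roots[of A n] A n by simp
    show "degree p \<le> n"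
      unfolding p_def by (intro degree_diff_le deg order.trans[OF degree_smult_le])
    show "degree (smult k (monom 1 n - [:A:])) \<le> n"
      by (intro order.trans[OF degree_smult_le] degree_diff_le degree_monom_le) simp
    show "poly p z = poly (smult k (monom 1 n - [:A:])) z" if "z \<in> {z. z ^ n = A}" for z
      using root[of z] that by (simp add: poly_monom)
  qed
  then have "coeff p i = 0" if "0 < i" "i < n" for i
    using that by (simp add: coeff_pCons split: nat.splits)
  then have coeffs: "of_nat (n choose i) * (a ^ i * b ^ (n - i)) = of_nat (n choose i) * (A * (c ^ i * e ^ (n - i)))"
    if "0 < i" "i < n" for i
    using that by (simp add: p_def coeff_linear_poly_power algebra_simps)
  have coeffs': "a ^ i * b ^ (n - i) = A * (c ^ i * e ^ (n - i))" if "0 < i" "i < n" for i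
    using coeffs[OF that] that by (simp add: binomial_eq_0_iff)
  obtain j where j: "n = j + 3" using n by (metis add.commute le_Suc_ex)
  have c1: "a * b ^ (j + 2) = A * (c * e ^ (j + 2))"
    using coeffs'[of 1] by (simp add: j eval_nat_numeral)
  have c2: "a ^ 2 * b ^ (j + 1) = A * (c ^ 2 * e ^ (j + 1))"
    using coeffs'[of 2] by (simp add: j eval_nat_numeral)
  \<comment> \<open>Dividing the two relations would give \<open>a / c = b / e\<close>, contradicting the determinant.\<close>
  have ab: "a * b = 0"
  proof (rule ccontr)
    assume nz: "a * b \<noteq> 0"
    then have "c * e ^ (j + 2) \<noteq> 0" using c1 A by auto
    then have "e \<noteq> 0" "c \<noteq> 0" by auto
    have "a * b ^ (j + 1) * e * (b * c) = (a * b ^ (j + 2)) * (c * e)"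
      by (simp add: algebra_simps)
    also have "\<dots> = (A * (c ^ 2 * e ^ (j + 1))) * e ^ 2"
      unfolding c1 by (simp add: algebra_simps power2_eq_square)
    also have "\<dots> = (a ^ 2 * b ^ (j + 1)) * e ^ 2"
      unfolding c2 ..
    also have "\<dots> = a * b ^ (j + 1) * e * (a * e)"
      by (simp add: algebra_simps power2_eq_square)
    finally have "b * c = a * e" using nz \<open>e \<noteq> 0\<close> by simp
    with det show False by simp
  qed
  then have "c * e = 0" using c1 A by auto
  show thesis
  proof (cases "a = 0")
    case True
    with det \<open>c * e = 0\<close> have "b \<noteq> 0" "c \<noteq> 0" "e = 0" by auto
    moreover have "\<mu> = inversion (b / c)"
      using \<open>a = 0\<close> calculation by (intro rsphere_eqI) (auto simp: m rat_map_def field_simps)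
    ultimately show thesis using that[of "b / c"] by simp
  next
    case False
    with ab det \<open>c * e = 0\<close> have "b = 0" "c = 0" "e \<noteq> 0" by auto
    moreover have "\<mu> = rotation (a / e)"
      using \<open>a \<noteq> 0\<close> calculation by (intro rsphere_eqI) (auto simp: m rat_map_def field_simps)
    ultimately show thesis using that[of "a / e"] False by simp
  qed
qed

section \<open>Words in the dihedral generators\<close>

lemma pres_eq_append: "pres_eq rels u v \<Longrightarrow> pres_eq rels (x @ u @ y) (x @ v @ y)"
proof (induction rule: pres_eq.induct)
  case (cancel u z b v)
  show ?case using pres_eq.cancel[of rels "x @ u" z b "v @ y"] by simp
next
  case (relator r u v)
  show ?case using pres_eq.relator[OF relator, of "x @ u" "v @ y"] by simp
qed (auto intro: pres_eq.intros)

lemma pres_eq_append_left: "pres_eq rels u v \<Longrightarrow> pres_eq rels (x @ u) (x @ v)"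
  using pres_eq_append[of rels u v x "[]"] by simp

text \<open>
  A presented group is recognised by an evaluation of words which identifies exactly the congruent
  ones: the isomorphism sends an element to the class of all words that evaluate to it.
\<close>

lemma presented_group_iso:
  fixes ev :: "('g \<times> bool) list \<Rightarrow> 'a" and G :: "('a, 'b) monoid_scheme"
  assumes range: "range ev = carrier G"
    and append: "\<And>u v. ev (u @ v) = ev u \<otimes>\<^bsub>G\<^esub> ev v"
    and faithful: "\<And>u v. ev u = ev v \<longleftrightarrow> pres_eq rels u v"
  shows "G \<cong> presented_group rels"
proof -
  define \<phi> where "\<phi> = (\<lambda>x. {w. ev w = x})"
  have cls: "\<phi> (ev u) = {(u, v). pres_eq rels u v} `` {u}" for u
    by (auto simp: \<phi>_def faithful[symmetric])
  have "\<phi> \<in> hom G (presented_group rels)"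
  proof (rule homI)
    fix x assume "x \<in> carrier G"
    then obtain u where x: "x = ev u" using range by blast
    have "\<phi> x \<in> UNIV // {(u, v). pres_eq rels u v}"
      unfolding x cls by (rule quotientI) simp
    then show "\<phi> x \<in> carrier (presented_group rels)"
      by (simp add: presented_group_def)
  next
    fix x y assume "x \<in> carrier G" "y \<in> carrier G"
    then obtain u v where x: "x = ev u" and y: "y = ev v" using range by blast
    show "\<phi> (x \<otimes>\<^bsub>G\<^esub> y) = \<phi> x \<otimes>\<^bsub>presented_group rels\<^esub> \<phi> y"
      by (auto simp: presented_group_def \<phi>_def faithful[symmetric] append x y)
  qed
  moreover have "bij_betw \<phi> (carrier G) (carrier (presented_group rels))"
    unfolding bij_betw_def
  proof
    show "inj_on \<phi> (carrier G)"
      unfolding inj_on_def \<phi>_def range[symmetric] by auto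
    show "\<phi> ` carrier G = carrier (presented_group rels)"
      unfolding range[symmetric] image_image cls presented_group_def quotient_def by auto
  qed
  ultimately show ?thesis unfolding is_iso_def iso_def by blast
qed

definition dihedral_relators :: "nat \<Rightarrow> (dihedral_gen \<times> bool) list set" where
  "dihedral_relators n =
    {replicate n (Rot, True),
     [(Flip, True), (Flip, True)],
     [(Rot, True), (Flip, True), (Rot, True), (Flip, True)]}"

lemma dihedral_group_alt: "dihedral_group n = presented_group (dihedral_relators n)"
  by (simp add: dihedral_group_def dihedral_relators_def)

abbreviation rots :: "nat \<Rightarrow> (dihedral_gen \<times> bool) list" where
  "rots k \<equiv> replicate k (Rot, True)"

abbreviation flips :: "nat \<Rightarrow> (dihedral_gen \<times> bool) list" where
  "flips k \<equiv> replicate k (Flip, True)"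

context
  fixes n :: nat
  assumes n: "n \<ge> 1"
begin

private abbreviation peq (infix "\<sim>" 50) where "u \<sim> v \<equiv> pres_eq (dihedral_relators n) u v"

lemmas [trans] = pres_eq.trans[where rels = "dihedral_relators n"]

lemma rots_reduce: "rots (k + n) @ v \<sim> rots k @ v"
  using pres_eq.relator[of "rots n" "dihedral_relators n" "rots k" v]
  by (simp add: dihedral_relators_def replicate_add)

lemma rots_mod: "rots k @ v \<sim> rots (k mod n) @ v"
proof (induction k rule: less_induct)
  case (less k)
  show ?case
  proof (cases "k < n")
    case True
    then show ?thesis by (simp add: pres_eq.refl)
  next
    case False
    with n less.IH[of "k - n"] have "rots (k - n) @ v \<sim> rots (k mod n) @ v"
      by (simp add: le_mod_geq)
    with rots_reduce[of "k - n" v] False show ?thesis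
      by (auto intro: pres_eq.trans)
  qed
qed

lemma flips_mod: "flips k \<sim> flips (k mod 2)"
proof (induction k rule: less_induct)
  case (less k)
  show ?case
  proof (cases "k < 2")
    case True
    then show ?thesis by (simp add: pres_eq.refl)
  next
    case False
    then obtain j where j: "k = j + 2" by (metis add.commute le_Suc_ex not_less)
    have "flips (j + 2) \<sim> flips j"
      using pres_eq.relator[of "flips 2" "dihedral_relators n" "[]" "flips j"]
      by (simp add: dihedral_relators_def eval_nat_numeral)
    also have "flips j \<sim> flips (j mod 2)" using less[of j] j by simp
    finally show ?thesis by (simp add: j)
  qed
qed

lemma inverse_rot: "(Rot, False) # v \<sim> rots (n - 1) @ v"
proof -
  have "(Rot, False) # v \<sim> (Rot, False) # rots n @ v"
    using pres_eq.relator[of "rots n" "dihedral_relators n" "[(Rot, False)]" v]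
    by (auto simp: dihedral_relators_def intro: pres_eq.sym)
  also have "(Rot, False) # rots n @ v \<sim> rots (n - 1) @ v"
    using pres_eq.cancel[of "dihedral_relators n" "[]" Rot False "rots (n - 1) @ v"] n
    by (cases n) auto
  finally show ?thesis .
qed

lemma inverse_flip: "(Flip, False) # v \<sim> (Flip, True) # v"
proof -
  have "(Flip, False) # v \<sim> (Flip, False) # (Flip, True) # (Flip, True) # v"
    using pres_eq.relator[of "flips 2" "dihedral_relators n" "[(Flip, False)]" v]
    by (auto simp: dihedral_relators_def eval_nat_numeral intro: pres_eq.sym)
  also have "\<dots> \<sim> (Flip, True) # v"
    using pres_eq.cancel[of "dihedral_relators n" "[]" Flip False "(Flip, True) # v"] by simp
  finally show ?thesis .
qed

text \<open>
  Inserting \<open>F F\<close> at the end and \<open>R^-1 R\<close> at the front of \<open>F R\<close> exposes the relator \<open>R F R F\<close>.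
\<close>

lemma flip_rot: "(Flip, True) # (Rot, True) # v \<sim> rots (n - 1) @ (Flip, True) # v"
proof -
  let ?R = "(Rot, True)" and ?F = "(Flip, True)"
  have "?F # ?R # v \<sim> ?F # ?R # ?F # ?F # v"
    using pres_eq.relator[of "flips 2" "dihedral_relators n" "[?F, ?R]" v]
    by (auto simp: dihedral_relators_def eval_nat_numeral intro: pres_eq.sym)
  also have "\<dots> \<sim> (Rot, False) # ?R # ?F # ?R # ?F # ?F # v"
    using pres_eq.cancel[of "dihedral_relators n" "[]" Rot False "?F # ?R # ?F # ?F # v"]
    by (auto intro: pres_eq.sym)
  also have "\<dots> \<sim> (Rot, False) # ?F # v"
    using pres_eq.relator[of "[?R, ?F, ?R, ?F]" "dihedral_relators n" "[(Rot, False)]" "?F # v"]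
    by (auto simp: dihedral_relators_def)
  also have "\<dots> \<sim> rots (n - 1) @ ?F # v"
    by (rule inverse_rot)
  finally show ?thesis .
qed

lemma flip_rots: "(Flip, True) # rots k @ v \<sim> rots (k * (n - 1)) @ (Flip, True) # v"
proof (induction k)
  case 0
  then show ?case by (simp add: pres_eq.refl)
next
  case (Suc k)
  have "(Flip, True) # rots (Suc k) @ v \<sim> rots (n - 1) @ (Flip, True) # rots k @ v"
    using flip_rot[of "rots k @ v"] by simp
  also have "\<dots> \<sim> rots (n - 1) @ rots (k * (n - 1)) @ (Flip, True) # v"
    by (rule pres_eq_append_left[OF Suc])
  also have "\<dots> = rots (Suc k * (n - 1)) @ (Flip, True) # v"
    by (simp add: replicate_add)
  finally show ?case .
qed

text \<open>
  This bounds the order of the presented group by \<open>2 n\<close>. Letters are absorbed one at a time from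
  the left; a rotation stays in front, and a flip moves to the right past all rotations. The
  inverse letters are traded for positive powers, so no negative exponents occur.
\<close>

lemma dihedral_normal_form: "\<exists>k<n. \<exists>e<2. u \<sim> rots k @ flips e"
proof -
  have "\<exists>k e. u \<sim> rots k @ flips e"
  proof (induction u)
    case Nil
    have "[] \<sim> rots 0 @ flips 0" by (simp add: pres_eq.refl)
    then show ?case by blast
  next
    case (Cons l u)
    then obtain k e where "u \<sim> rots k @ flips e" by blast
    then have step: "l # u \<sim> l # rots k @ flips e"
      using pres_eq_append_left[of "dihedral_relators n" u _ "[l]"] by simp
    have flip: "(Flip, True) # rots k @ flips e \<sim> rots (k * (n - 1)) @ flips (Suc e)"
      using flip_rots[of k "flips e"] by simp
    obtain g b where l: "l = (g, b)" by (cases l)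
    have "\<exists>k' e'. l # rots k @ flips e \<sim> rots k' @ flips e'"
    proof (cases g; cases b)
      assume "g = Rot" "b"
      then have "l # rots k @ flips e \<sim> rots (Suc k) @ flips e" by (simp add: l pres_eq.refl)
      then show ?thesis by blast
    next
      assume "g = Rot" "\<not> b"
      then have "l # rots k @ flips e \<sim> rots (n - 1 + k) @ flips e"
        using inverse_rot[of "rots k @ flips e"] by (simp add: l replicate_add)
      then show ?thesis by blast
    next
      assume "g = Flip" "b"
      then have "l = (Flip, True)" by (simp add: l)
      then show ?thesis using flip by blast
    next
      assume "g = Flip" "\<not> b"
      then have "l = (Flip, False)" by (simp add: l)
      then show ?thesis using flip inverse_flip[of "rots k @ flips e"] by (blast intro: pres_eq.trans)
    qed
    with step show ?case by (meson pres_eq.trans)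
  qed
  then obtain k e where "u \<sim> rots k @ flips e" by blast
  also have "\<dots> \<sim> rots (k mod n) @ flips e" by (rule rots_mod)
  also have "\<dots> \<sim> rots (k mod n) @ flips (e mod 2)"
    by (rule pres_eq_append_left[OF flips_mod])
  finally show ?thesis using n by (metis mod_less_divisor zero_less_numeral less_le_trans zero_less_one)
qed

end

section \<open>Dihedral groups of rotations and inversions\<close>

text \<open>
  The sign of a flip is ignored because inversions are involutions.
\<close>

fun eval_word :: "complex \<Rightarrow> complex \<Rightarrow> (dihedral_gen \<times> bool) list \<Rightarrow> rsphere \<Rightarrow> rsphere" where
  "eval_word \<zeta> b [] = id"
| "eval_word \<zeta> b ((Rot, s) # w) = rotation (if s then \<zeta> else inverse \<zeta>) \<circ> eval_word \<zeta> b w"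
| "eval_word \<zeta> b ((Flip, s) # w) = inversion b \<circ> eval_word \<zeta> b w"

lemma eval_word_append: "eval_word \<zeta> b (u @ v) = eval_word \<zeta> b u \<circ> eval_word \<zeta> b v"
  by (induction \<zeta> b u rule: eval_word.induct) (auto simp: comp_assoc)

lemma eval_word_rots: "\<zeta> \<noteq> 0 \<Longrightarrow> eval_word \<zeta> b (rots k) = rotation (\<zeta> ^ k)"
  by (induction k) (auto simp: rotation_rotation)

lemma eval_word_normal_form:
  assumes "\<zeta> \<noteq> 0" "e < 2"
  shows "eval_word \<zeta> b (rots k @ flips e) = (if e = 0 then rotation (\<zeta> ^ k) else inversion (\<zeta> ^ k * b))"
proof -
  have "e = 0 \<or> e = 1" using assms by auto
  then show ?thesis
    using assms by (auto simp: eval_word_append eval_word_rots rotation_inversion)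
qed

lemma eval_word_pres_eq:
  assumes \<zeta>: "\<zeta> \<noteq> 0" "\<zeta> ^ n = 1" and b: "b \<noteq> 0" and "pres_eq (dihedral_relators n) u v"
  shows "eval_word \<zeta> b u = eval_word \<zeta> b v"
  using assms(4)
proof (induction rule: pres_eq.induct)
  case (cancel u g s v)
  have pair: "eval_word \<zeta> b [(g, s), (g, \<not> s)] = id"
    using \<zeta> b by (cases g; cases s) (auto simp: rotation_rotation inversion_inversion)
  then show ?case by (simp only: eval_word_append pair id_comp)
next
  case (relator r u v)
  have "eval_word \<zeta> b r = id"
    using relator \<zeta> b unfolding dihedral_relators_def
    by (auto simp: eval_word_rots rotation_rotation rotation_inversion inversion_inversion comp_assoc)
  then show ?case by (simp add: eval_word_append)
qed auto

text \<open>
  The generators are \<open>z \<mapsto> \<zeta> z\<close> for a primitive \<open>n\<close>-th root of unity \<open>\<zeta>\<close> and \<open>z \<mapsto> b / z\<close> for any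
  \<open>b\<close> with \<open>b^n = C\<close>. The normal forms evaluate to \<open>z \<mapsto> \<zeta>^k z\<close> and \<open>z \<mapsto> \<zeta>^k b / z\<close> with
  \<open>k < n\<close>, which are pairwise distinct and exhaust the given maps.
\<close>

lemma rotations_inversions_dihedral:
  assumes n: "n \<ge> 1" and C: "C \<noteq> 0"
    and carrier: "carrier G = rotation ` {c. c ^ n = 1} \<union> inversion ` {c. c ^ n = C}"
    and mult: "monoid.mult G = (\<circ>)"
  shows "G \<cong> dihedral_group n"
proof -
  define \<zeta> where "\<zeta> = cis (2 * pi / real n)"
  have \<zeta>0: "\<zeta> \<noteq> 0" by (simp add: \<zeta>_def)
  have "bij_betw (\<lambda>k. \<zeta> ^ k) {..<n} {z. z ^ n = 1}"
    using bij_betw_roots_unity[of n] n by (simp add: \<zeta>_def DeMoivre mult_ac)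
  then have inj: "inj_on (\<lambda>k. \<zeta> ^ k) {..<n}" and img: "(\<lambda>k. \<zeta> ^ k) ` {..<n} = {z. z ^ n = 1}"
    by (auto simp: bij_betw_def)
  have "{z::complex. z ^ n = C} \<noteq> {}"
    using card_nth_roots[OF C, of n] n by force
  then obtain b where b: "b ^ n = C" by blast
  with C n have b0: "b \<noteq> 0" by auto
  have \<zeta>n: "\<zeta> ^ n = 1"
    using n by (simp add: \<zeta>_def DeMoivre)
  let ?ev = "eval_word \<zeta> b"
  have respects: "?ev u = ?ev v" if "pres_eq (dihedral_relators n) u v" for u v
    using eval_word_pres_eq[OF \<zeta>0 \<zeta>n b0 that] .
  have reflects: "pres_eq (dihedral_relators n) u v" if "?ev u = ?ev v" for u v
  proof -
    obtain k e where u: "k < n" "e < 2" "pres_eq (dihedral_relators n) u (rots k @ flips e)"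
      using dihedral_normal_form[OF n] by blast
    obtain k' e' where v: "k' < n" "e' < 2" "pres_eq (dihedral_relators n) v (rots k' @ flips e')"
      using dihedral_normal_form[OF n] by blast
    have "?ev (rots k @ flips e) = ?ev (rots k' @ flips e')"
      using respects[OF u(3)] respects[OF v(3)] that by simp
    then have "\<zeta> ^ k = \<zeta> ^ k' \<and> e = e'"
      using u(2) v(2) b0 by (auto simp: eval_word_normal_form \<zeta>0 split: if_splits)
    then have "k = k'" "e = e'"
      using inj u(1) v(1) by (auto dest: inj_onD)
    then show ?thesis using u(3) v(3) by (meson pres_eq.sym pres_eq.trans)
  qed
  have "range ?ev = carrier G"
  proof
    show "range ?ev \<subseteq> carrier G"
    proof (rule image_subsetI)
      fix u
      obtain k e where u: "k < n" "e < 2" "pres_eq (dihedral_relators n) u (rots k @ flips e)"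
        using dihedral_normal_form[OF n] by blast
      have "(\<zeta> ^ k) ^ n = 1" by (metis \<zeta>n power_commutes power_mult mult.commute power_one)
      then show "?ev u \<in> carrier G"
        unfolding carrier respects[OF u(3)] eval_word_normal_form[OF \<zeta>0 u(2)]
        by (auto simp: power_mult_distrib b)
    qed
    show "carrier G \<subseteq> range ?ev"
    proof
      fix x assume "x \<in> carrier G"
      then consider c where "c ^ n = 1" "x = rotation c" | c where "c ^ n = C" "x = inversion c"
        by (auto simp: carrier)
      then show "x \<in> range ?ev"
      proof cases
        case 1
        then obtain k where "c = \<zeta> ^ k" using img by blast
        then have "x = ?ev (rots k @ flips 0)"
          using 1 by (simp add: eval_word_normal_form[OF \<zeta>0] del: replicate_0)
        then show ?thesis by blast
      next
        case 2
        then have "(c / b) ^ n = 1" using b C by (simp add: power_divide)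
        then obtain k where "c / b = \<zeta> ^ k" using img by blast
        then have "c = \<zeta> ^ k * b" using b0 by (simp add: field_simps)
        then have "x = ?ev (rots k @ flips 1)"
          using 2 by (subst eval_word_normal_form[OF \<zeta>0]) auto
        then show ?thesis by blast
      qed
    qed
  qed
  then show ?thesis
    unfolding dihedral_group_alt
    by (rule presented_group_iso) (auto simp: mult eval_word_append intro: respects reflects)
qed

lemma deck_group_dihedral:
  assumes "n \<ge> 1" and "C \<noteq> 0"
    and rot: "\<And>c. c ^ n = 1 \<Longrightarrow> F \<circ> rotation c = F"
    and inv: "\<And>c. c ^ n = C \<Longrightarrow> F \<circ> inversion c = F"
    and only: "\<And>\<mu>. \<mu> \<in> moebius_maps \<Longrightarrow> F \<circ> \<mu> = F \<Longrightarrow>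
      \<exists>c. c ^ n = 1 \<and> \<mu> = rotation c \<or> c ^ n = C \<and> \<mu> = inversion c"
  shows "deck_group F \<cong> dihedral_group n"
proof (rule rotations_inversions_dihedral[OF assms(1,2)])
  have nz: "c \<noteq> 0" if "c ^ n = 1 \<or> c ^ n = C" for c
    using that assms(1,2) by (cases n) auto
  show "carrier (deck_group F) = rotation ` {c. c ^ n = 1} \<union> inversion ` {c. c ^ n = C}"
    using rot inv only nz
    by (auto simp: deck_group_def intro!: rotation_moebius inversion_moebius) blast+
qed (simp add: deck_group_def)

section \<open>The bicritical map and its symmetries\<close>

definition bicritical :: "nat \<Rightarrow> complex \<Rightarrow> rsphere \<Rightarrow> rsphere" where
  "bicritical d a = rat_map (monom 1 d - [:a:]) (monom 1 d + [:a:])"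

lemma bicritical_Some:
  "bicritical d a (Some z) = (if z ^ d + a = 0 then None else Some ((z ^ d - a) / (z ^ d + a)))"
  by (simp add: bicritical_def rat_map_def poly_monom)

lemma bicritical_None:
  assumes "0 < d"
  shows "bicritical d a None = Some 1"
proof -
  have deg: "degree (monom 1 d + [:c:]) = d" for c :: complex
    using assms by (subst degree_add_eq_left) (auto simp: degree_monom_eq)
  have "monom 1 d - [:a:] = monom 1 d + [:-a:]" by simp
  then have "degree (monom 1 d + [:a:]) = d" "degree (monom 1 d - [:a:]) = d"
    using deg[of a] deg[of "-a"] by (simp_all only:)
  then show ?thesis
    using assms by (simp add: bicritical_def rat_map_def coeff_pCons split: nat.splits)
qed

context
  fixes d :: nat and a :: complex
  assumes d: "d \<ge> 2" and even: "even d" and a: "a \<noteq> 0"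
begin

private abbreviation "f \<equiv> bicritical d a"

lemma d_pos: "0 < d"
  using d by simp

lemma bicritical_eq_minus_1_iff: "f x = Some (-1) \<longleftrightarrow> x = Some 0"
proof (cases x)
  case (Some z)
  show ?thesis
  proof (cases "z ^ d + a = 0")
    case True
    then show ?thesis using a d_pos Some by (auto simp: bicritical_Some zero_power)
  next
    case False
    then have "(z ^ d - a) / (z ^ d + a) = -1 \<longleftrightarrow> z ^ d = 0"
      by (simp add: divide_eq_eq)
    then show ?thesis using False d_pos Some by (simp add: bicritical_Some)
  qed
qed (simp add: bicritical_None d_pos)

lemma bicritical_eq_1_iff: "f x = Some 1 \<longleftrightarrow> x = None"
  using a d_pos by (cases x) (auto simp: bicritical_None bicritical_Some divide_eq_eq)

lemma bicritical_eq_0_iff: "f x = Some 0 \<longleftrightarrow> (\<exists>z. x = Some z \<and> z ^ d = a)"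
  using a d_pos by (cases x) (auto simp: bicritical_None bicritical_Some)

lemma bicritical_eq_None_iff: "f x = None \<longleftrightarrow> (\<exists>z. x = Some z \<and> z ^ d = - a)"
  using d_pos by (cases x) (auto simp: bicritical_None bicritical_Some eq_neg_iff_add_eq_0)

lemma bicritical_eq_iff:
  "f x = f y \<longleftrightarrow> map_option (\<lambda>z. z ^ d) x = map_option (\<lambda>z. z ^ d) y"
proof (cases "x = None \<or> y = None")
  case True
  then show ?thesis using bicritical_eq_1_iff by (metis d_pos option.map_disc_iff bicritical_None)
next
  case False
  then obtain u v where "x = Some u" "y = Some v" by auto
  moreover have "(u ^ d - a) / (u ^ d + a) = (v ^ d - a) / (v ^ d + a) \<longleftrightarrow> u ^ d = v ^ d"
    if "u ^ d + a \<noteq> 0" "v ^ d + a \<noteq> 0"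
  proof -
    have "(u ^ d - a) / (u ^ d + a) = (v ^ d - a) / (v ^ d + a) \<longleftrightarrow> 2 * a * (u ^ d - v ^ d) = 0"
      using that by (simp add: frac_eq_eq algebra_simps)
    then show ?thesis using a by simp
  qed
  ultimately show ?thesis
    by (auto simp: bicritical_Some simp flip: eq_neg_iff_add_eq_0)
qed

lemma bicritical_rotation:
  assumes "c ^ d = 1"
  shows "f \<circ> rotation c = f"
proof -
  have "c \<noteq> 0" using assms d_pos by (auto simp: zero_power)
  then show ?thesis
    using assms by (intro rsphere_eqI) (auto simp: bicritical_Some power_mult_distrib)
qed

lemma bicritical_inversion:
  assumes "c ^ d = a ^ 2"
  shows "f \<circ> inversion c = rotation (-1) \<circ> f"
proof (rule rsphere_eqI)
  show "(f \<circ> inversion c) None = (rotation (-1) \<circ> f) None"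
    using d_pos a by (simp add: bicritical_None bicritical_Some zero_power)
  show "(f \<circ> inversion c) (Some z) = (rotation (-1) \<circ> f) (Some z)" for z
  proof (cases "z = 0")
    case False
    then have "a ^ 2 / z ^ d + a = a / z ^ d * (z ^ d + a)" "a ^ 2 / z ^ d - a = a / z ^ d * - (z ^ d - a)"
      by (simp_all add: field_simps power2_eq_square)
    then show ?thesis using False a assms
      by (simp add: bicritical_Some power_divide del: mult_minus_right)
  qed (use d_pos a in \<open>simp add: zero_power bicritical_None bicritical_Some\<close>)
qed

lemma bicritical_rotation_minus:
  assumes "c ^ d = -1"
  shows "f \<circ> rotation c = inversion 1 \<circ> f"
proof (rule rsphere_eqI)
  have "c \<noteq> 0" using assms d_pos by (auto simp: zero_power)
  then show "(f \<circ> rotation c) None = (inversion 1 \<circ> f) None"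
    using d_pos by (simp add: bicritical_None)
  show "(f \<circ> rotation c) (Some z) = (inversion 1 \<circ> f) (Some z)" for z
  proof -
    define u where "u = z ^ d"
    have u: "(c * z) ^ d = - u" using assms by (simp add: u_def power_mult_distrib)
    consider "u = a" | "u = - a" | "u - a \<noteq> 0" "u + a \<noteq> 0"
      by (metis eq_iff_diff_eq_0 eq_neg_iff_add_eq_0)
    then show ?thesis
    proof cases
      case 3
      have "- u + a = - (u - a)" "- u - a = - (u + a)" by simp_all
      then have "- u + a \<noteq> 0" "(- u - a) / (- u + a) = (u + a) / (u - a)"
        using 3 by (metis neg_equal_0_iff_equal, metis minus_divide_divide)
      then show ?thesis
        using 3 by (simp add: bicritical_Some u flip: u_def)
    qed (use a in \<open>auto simp: bicritical_Some u simp flip: u_def\<close>)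
  qed
qed

lemma bicritical_negation: "f \<circ> rotation (-1) = f"
  using even by (intro bicritical_rotation) simp

text \<open>
  The points over \<open>-1\<close> are those with \<open>f z = 0\<close> and the points over \<open>1\<close> those with \<open>f z = \<infinity>\<close>,
  since \<open>0\<close> and \<open>\<infinity>\<close> are totally ramified over \<open>-1\<close> and \<open>1\<close>. A deck transformation preserves both
  fibres. The union is needed for rigidity, while the fibre over \<open>-1\<close> alone then decides which
  constants \<open>c\<close> are possible.
\<close>

lemma deck_group_bicritical_2: "deck_group (f ^^ 2) \<cong> dihedral_group d"
proof (rule deck_group_dihedral[where C = "a ^ 2"])
  have ff: "f ^^ 2 = f \<circ> f" by (simp add: eval_nat_numeral)
  show "d \<ge> 1" "a ^ 2 \<noteq> 0" using d a by auto
  show "f ^^ 2 \<circ> rotation c = f ^^ 2" if "c ^ d = 1" for c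
    by (simp add: ff comp_assoc bicritical_rotation[OF that])
  show "f ^^ 2 \<circ> inversion c = f ^^ 2" if "c ^ d = a ^ 2" for c
    by (metis ff comp_assoc bicritical_inversion[OF that] bicritical_negation)
  fix \<mu> assume \<mu>: "\<mu> \<in> moebius_maps" "f ^^ 2 \<circ> \<mu> = f ^^ 2"
  then have inv: "f (f (\<mu> x)) = f (f x)" for x
    by (metis comp_apply ff)
  have zeros: "\<exists>w. \<mu> (Some z) = Some w \<and> w ^ d = a" if "z ^ d = a" for z
    using inv[of "Some z"] that bicritical_eq_minus_1_iff bicritical_eq_0_iff by metis
  have poles: "\<exists>w. \<mu> (Some z) = Some w \<and> w ^ d = - a" if "z ^ d = - a" for z
    using inv[of "Some z"] that bicritical_eq_1_iff bicritical_eq_None_iff by metis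
  have split: "z ^ (d * 2) = a ^ 2 \<longleftrightarrow> z ^ d = a \<or> z ^ d = - a" for z
    by (simp add: power_mult power2_eq_iff)
  obtain c where c: "c \<noteq> 0" "\<mu> = rotation c \<or> \<mu> = inversion c"
  proof (rule moebius_preserving_nth_roots[OF \<mu>(1), of "d * 2" "a ^ 2"])
    show "\<exists>w. \<mu> (Some z) = Some w \<and> w ^ (d * 2) = a ^ 2" if "z ^ (d * 2) = a ^ 2" for z
      using that zeros[of z] poles[of z] unfolding split by blast
  qed (use d a in auto)
  have "{z::complex. z ^ d = a} \<noteq> {}"
    using card_nth_roots[OF a, of d] d by force
  then obtain z where z: "z ^ d = a" by blast
  then have "z \<noteq> 0" using a d by auto
  with zeros[OF z] c z a show "\<exists>c. c ^ d = 1 \<and> \<mu> = rotation c \<or> c ^ d = a ^ 2 \<and> \<mu> = inversion c"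
    by (auto simp: power_mult_distrib power_divide divide_eq_eq power2_eq_square)
qed

end

section \<open>The third iterate\<close>

text \<open>
  For \<open>a = 1\<close>, the second iterate is \<open>num2 d z / den2 d z\<close>, and the third iterate depends on its
  \<open>d\<close>-th power only. Working one iterate below the third keeps the derivative computation short.
\<close>

definition num2 :: "nat \<Rightarrow> complex \<Rightarrow> complex" where
  "num2 d z = (z ^ d - 1) ^ d - (z ^ d + 1) ^ d"

definition den2 :: "nat \<Rightarrow> complex \<Rightarrow> complex" where
  "den2 d z = (z ^ d - 1) ^ d + (z ^ d + 1) ^ d"

lemma bicritical_1_twice:
  assumes "d \<ge> 2"
  shows "bicritical d 1 (bicritical d 1 (Some z)) =
    (if den2 d z = 0 then None else Some (num2 d z / den2 d z))"
proof (cases "z ^ d + 1 = 0")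
  case True
  then have "z ^ d = -1" by (simp add: eq_neg_iff_add_eq_0)
  then show ?thesis using assms
    by (simp add: bicritical_Some bicritical_None zero_power num2_def den2_def)
next
  case False
  then have "((z ^ d - 1) / (z ^ d + 1)) ^ d + 1 = den2 d z / (z ^ d + 1) ^ d"
    "((z ^ d - 1) / (z ^ d + 1)) ^ d - 1 = num2 d z / (z ^ d + 1) ^ d"
    by (simp_all add: num2_def den2_def power_divide field_simps)
  then show ?thesis using False by (simp add: bicritical_Some)
qed

text \<open>
  For \<open>d \<ge> 2\<close> the factored form of the derivative shows the finite critical points of the second
  iterate that are not poles: \<open>0\<close> and the \<open>2 d\<close>-th roots of unity.
\<close>

lemma DERIV_num2_div_den2:
  assumes "den2 d z \<noteq> 0"
  shows "((\<lambda>z. num2 d z / den2 d z) has_field_derivative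
    4 * of_nat d ^ 2 * z ^ (d - 1) * ((z ^ d) ^ 2 - 1) ^ (d - 1) / den2 d z ^ 2) (at z)"
proof (cases d)
  case (Suc m)
  have "((\<lambda>z. num2 d z / den2 d z) has_field_derivative (
      ((of_nat d * (z ^ d - 1) ^ m * (of_nat d * z ^ m) - of_nat d * (z ^ d + 1) ^ m * (of_nat d * z ^ m)) * den2 d z
      - num2 d z *
       (of_nat d * (z ^ d - 1) ^ m * (of_nat d * z ^ m) + of_nat d * (z ^ d + 1) ^ m * (of_nat d * z ^ m)))
      / (den2 d z * den2 d z))) (at z)"
    using assms unfolding num2_def den2_def
    by (auto intro!: derivative_eq_intros simp: Suc mult_ac simp del: of_nat_Suc power_Suc)
  moreover have "((of_nat d * (x - 1) ^ m * (of_nat d * y) - of_nat d * (x + 1) ^ m * (of_nat d * y))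
        * ((x - 1) ^ d + (x + 1) ^ d)
      - ((x - 1) ^ d - (x + 1) ^ d) *
       (of_nat d * (x - 1) ^ m * (of_nat d * y) + of_nat d * (x + 1) ^ m * (of_nat d * y)))
      = 4 * of_nat d ^ 2 * y * (x ^ 2 - 1) ^ m" for x y :: complex
  proof -
    have sq: "(x ^ 2 - 1) ^ m = (x - 1) ^ m * (x + 1) ^ m"
      unfolding power_mult_distrib[symmetric] by (simp add: algebra_simps power2_eq_square)
    show ?thesis unfolding sq
      by (simp add: Suc algebra_simps power2_eq_square del: of_nat_Suc)
  qed
  ultimately show ?thesis
    by (simp add: Suc num2_def den2_def power2_eq_square del: of_nat_Suc power_Suc)
qed (use assms in \<open>simp add: num2_def\<close>)

text \<open>
  Near a point with finite image, a Moebius map of the sphere is a complex function with nonvanishing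
  derivative, which makes the chain rule applicable in the affine chart.
\<close>

lemma moebius_DERIV:
  assumes "\<mu> \<in> moebius_maps" and "\<mu> (Some z) = Some w"
  obtains m D where "(m has_field_derivative D) (at z)" "D \<noteq> 0" "m z = w"
    "\<forall>\<^sub>F y in nhds z. \<mu> (Some y) = Some (m y)"
proof -
  from assms(1) obtain a b c e where \<mu>: "\<mu> = rat_map [:b, a:] [:e, c:]" and det: "a * e - b * c \<noteq> 0"
    unfolding moebius_maps_def by blast
  define m where "m = (\<lambda>y. (b + y * a) / (e + y * c))"
  have nz: "e + z * c \<noteq> 0" and w: "m z = w"
    using assms(2) by (auto simp: \<mu> rat_map_def m_def split: if_splits)
  have "(m has_field_derivative (a * e - b * c) / (e + z * c) ^ 2) (at z)"
    unfolding m_def using nz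
    by (auto intro!: derivative_eq_intros simp: power2_eq_square algebra_simps)
  moreover have "isCont (\<lambda>y. e + y * c) z" by (intro continuous_intros)
  then have "\<forall>\<^sub>F y in nhds z. e + y * c \<noteq> 0"
    using nz by (auto simp: continuous_at tendsto_nhds_iff intro: tendsto_imp_eventually_ne)
  then have "\<forall>\<^sub>F y in nhds z. \<mu> (Some y) = Some (m y)"
    by eventually_elim (simp add: \<mu> rat_map_def m_def)
  ultimately show thesis using that nz det w by simp
qed

text \<open>
  Let \<open>X\<close> be the second iterate. The third iterates at \<open>\<mu> y\<close> and \<open>y\<close> agree, so
  \<open>X (\<mu> y)^d = X y^d\<close> for \<open>y\<close> near \<open>z\<close>. Both \<open>z\<close> and \<open>w = \<mu> z\<close> are finite with \<open>X^d = 1\<close>, and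
  \<open>X' z = 0\<close>. Differentiating gives \<open>X' w = 0\<close>, as neither \<open>X w\<close> nor the derivative of \<open>\<mu>\<close> vanishes.
  Of the zeros of \<open>X'\<close>, the origin is excluded by \<open>X 0 = 0\<close>, which leaves \<open>w^(2d) = 1\<close>.
\<close>

lemma deck_third_iterate_preserves_critical_fibre:
  assumes d: "d \<ge> 2" "even d"
    and \<mu>: "\<mu> \<in> moebius_maps" "bicritical d 1 ^^ 3 \<circ> \<mu> = bicritical d 1 ^^ 3"
    and z: "z ^ (2 * d) = 1"
  shows "\<exists>w. \<mu> (Some z) = Some w \<and> w ^ (2 * d) = 1"
proof -
  let ?g = "bicritical d 1"
  define X where "X = (\<lambda>z. num2 d z / den2 d z)"
  have XI: "?g (?g (Some y)) = (if den2 d y = 0 then None else Some (X y))" for y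
    unfolding X_def by (rule bicritical_1_twice[OF d(1)])
  have "?g (?g (?g (\<mu> x))) = ?g (?g (?g x))" for x
    using fun_cong[OF \<mu>(2), of x] by (simp add: eval_nat_numeral)
  then have inv: "map_option (\<lambda>z. z ^ d) (?g (?g (\<mu> x))) = map_option (\<lambda>z. z ^ d) (?g (?g x))" for x
    using bicritical_eq_iff[OF d] by simp
  have "(z ^ d) ^ 2 = 1" using z by (simp add: power_mult mult.commute)
  then have "z ^ d = 1 \<or> z ^ d = -1" by (simp add: power2_eq_1_iff)
  then have "?g (?g (Some z)) = Some 1 \<or> ?g (?g (Some z)) = Some (-1)"
    using d by (auto simp: bicritical_Some bicritical_None zero_power)
  then have zd: "map_option (\<lambda>z. z ^ d) (?g (?g (Some z))) = Some 1" and Vz: "den2 d z \<noteq> 0"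
    using d(2) XI[of z] by (auto split: if_splits)
  have "\<mu> (Some z) \<noteq> None"
  proof
    assume "\<mu> (Some z) = None"
    then have "map_option (\<lambda>z. z ^ d) (?g (?g None)) = Some 1" using inv[of "Some z"] zd by simp
    then show False using d by (simp add: bicritical_Some bicritical_None zero_power)
  qed
  then obtain w where w: "\<mu> (Some z) = Some w" by auto
  then have Vw: "den2 d w \<noteq> 0" and Xw: "X w ^ d = 1"
    using inv[of "Some z"] zd XI[of w] by (auto split: if_splits)
  obtain m D where m: "(m has_field_derivative D) (at z)" "D \<noteq> 0" "m z = w"
    and ev: "\<forall>\<^sub>F y in nhds z. \<mu> (Some y) = Some (m y)"
    using moebius_DERIV[OF \<mu>(1) w] by blast
  have "isCont (den2 d) z" unfolding den2_def by (intro continuous_intros)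
  then have "\<forall>\<^sub>F y in nhds z. den2 d y \<noteq> 0"
    using Vz by (auto simp: continuous_at tendsto_nhds_iff intro: tendsto_imp_eventually_ne)
  with ev have "\<forall>\<^sub>F y in nhds z. X (m y) ^ d = X y ^ d"
  proof eventually_elim
    case (elim y)
    then show ?case using inv[of "Some y"] XI[of y] XI[of "m y"] by (auto split: if_splits)
  qed
  moreover
  define X' where "X' = (\<lambda>z. 4 * of_nat d ^ 2 * z ^ (d - 1) * ((z ^ d) ^ 2 - 1) ^ (d - 1) / den2 d z ^ 2)"
  have DX: "(X has_field_derivative X' y) (at y)" if "den2 d y \<noteq> 0" for y
    unfolding X_def X'_def by (rule DERIV_num2_div_den2[OF that])
  have "((\<lambda>y. X y ^ d) has_field_derivative of_nat d * (X' z * X z ^ (d - 1))) (at z)"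
    using DERIV_power[OF DX[OF Vz], of d] by simp
  moreover have "((\<lambda>y. X (m y)) has_field_derivative X' w * D) (at z)"
    using DERIV_chain2[OF _ m(1), of X] DX[OF Vw] m(3) by simp
  then have "((\<lambda>y. X (m y) ^ d) has_field_derivative of_nat d * (X' w * D * X w ^ (d - 1))) (at z)"
    using DERIV_power[of "\<lambda>y. X (m y)" _ z UNIV d] m(3) by simp
  ultimately have "of_nat d * (X' w * D * X w ^ (d - 1)) = of_nat d * (X' z * X z ^ (d - 1))"
    by (metis DERIV_cong_ev DERIV_unique)
  moreover have "X' z = 0" using \<open>(z ^ d) ^ 2 = 1\<close> d by (simp add: X'_def)
  moreover have "X w \<noteq> 0" using Xw d by (auto simp: zero_power)
  ultimately have "X' w = 0" using m(2) d by simp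
  moreover have "w \<noteq> 0"
  proof
    assume "w = 0"
    then show False using \<open>X w \<noteq> 0\<close> d by (simp add: X_def num2_def zero_power)
  qed
  ultimately have "(w ^ d) ^ 2 = 1" using Vw d by (auto simp: X'_def)
  then show ?thesis using w by (simp add: power_mult[symmetric] mult.commute)
qed

text \<open>
  The new symmetries come from \<open>c^d = -1\<close>: there \<open>g (c z) = 1 / g z\<close>, and \<open>z \<mapsto> 1 / z\<close> is a deck
  transformation of \<open>g^2\<close>. Conversely, once \<open>\<mu>\<close> is \<open>z \<mapsto> c z\<close> or \<open>z \<mapsto> c / z\<close>, the image \<open>c\<close> of
  \<open>1\<close> must be a \<open>2 d\<close>-th root of unity.
\<close>

lemma deck_group_bicritical_3:
  assumes d: "d \<ge> 2" "even d"
  shows "deck_group (bicritical d 1 ^^ 3) \<cong> dihedral_group (2 * d)"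
proof (rule deck_group_dihedral[where C = 1])
  let ?g = "bicritical d 1"
  have ggg: "?g ^^ 3 = ?g \<circ> (?g \<circ> ?g)" by (simp add: eval_nat_numeral comp_assoc)
  have neg: "?g \<circ> rotation (-1) = ?g"
    using bicritical_negation[OF d] by simp
  have sq: "c ^ d = 1 \<or> c ^ d = -1" if "c ^ (2 * d) = 1" for c :: complex
    using that by (simp add: mult.commute[of 2] power_mult power2_eq_1_iff)
  have gg_inv: "?g \<circ> ?g \<circ> inversion 1 = ?g \<circ> ?g"
    by (metis comp_assoc neg one_power2 power_one bicritical_inversion[OF d] zero_neq_one)
  show rot: "?g ^^ 3 \<circ> rotation c = ?g ^^ 3" if "c ^ (2 * d) = 1" for c
    using sq[OF that]
  proof
    assume "c ^ d = 1"
    then show ?thesis using bicritical_rotation[OF d, of 1 c] by (simp add: ggg comp_assoc)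
  next
    assume "c ^ d = -1"
    then have "?g \<circ> rotation c = inversion 1 \<circ> ?g" using bicritical_rotation_minus[OF d] by simp
    then show ?thesis by (metis ggg comp_assoc gg_inv)
  qed
  show "?g ^^ 3 \<circ> inversion c = ?g ^^ 3" if "c ^ (2 * d) = 1" for c
  proof -
    have "c \<noteq> 0" using that d by (auto simp: zero_power)
    then have "?g ^^ 3 \<circ> inversion c = ?g ^^ 3 \<circ> rotation c \<circ> inversion 1"
      by (simp add: comp_assoc rotation_inversion)
    also have "\<dots> = ?g ^^ 3" using rot[OF that] gg_inv by (metis ggg comp_assoc)
    finally show ?thesis .
  qed
  fix \<mu> assume \<mu>: "\<mu> \<in> moebius_maps" "?g ^^ 3 \<circ> \<mu> = ?g ^^ 3"
  note pres = deck_third_iterate_preserves_critical_fibre[OF d \<mu>]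
  obtain c where c: "c \<noteq> 0" "\<mu> = rotation c \<or> \<mu> = inversion c"
    by (rule moebius_preserving_nth_roots[OF \<mu>(1), of "2 * d" 1]) (use d pres in auto)
  with pres[of 1] show "\<exists>c. c ^ (2 * d) = 1 \<and> \<mu> = rotation c \<or> c ^ (2 * d) = 1 \<and> \<mu> = inversion c"
    by auto
qed (use d in auto)

theorem proposition6p1:
  fixes d :: nat
  assumes "d \<ge> 2" and "even d"
  shows "(\<forall>a::complex. a \<noteq> 0 \<longrightarrow>
            deck_group (rat_map (monom 1 d - [:a:]) (monom 1 d + [:a:]) ^^ 2)
              \<cong> dihedral_group d)
       \<and> deck_group (rat_map (monom 1 d - 1) (monom 1 d + 1) ^^ 3)
              \<cong> dihedral_group (2 * d)"
  using deck_group_bicritical_2[OF assms] deck_group_bicritical_3[OF assms]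
  by (simp add: bicritical_def one_pCons)

end
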